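(* Let $\mathbb{F}$ be a field. Every almost Abelian Lie algebra $\mathbf{L}$ over $\mathbb{F}$ can be written as a Lie algebra direct sum $$\mathbf{L}=\mathbf{L}_0\oplus\mathbf{W},$$ where $\mathbf{L}_0$ is an indecomposable almost Abelian Lie subalgebra and $\mathbf{W}$ is a possibly trivial Abelian Lie subalgebra. If $\mathbf{L}=\mathbf{L}_0'\oplus\mathbf{W}'$ is another such decomposition, then $\mathbf{L}_0\simeq\mathbf{L}_0'$ and $\mathbf{W}\simeq\mathbf{W}'$ as Lie algebras.
   Context: An almost Abelian Lie algebra over a field $\mathbb{F}$ (of arbitrary, possibly infinite, dimension) is a non-Abelian Lie algebra that contains a codimension 1 Abelian subalgebra. A Lie algebra is decomposable if it is the direct sum of two commuting nonzero Lie subalgebras; otherwise it is indecomposable. *)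

theory Defs
  imports Complex_Main
begin

text \<open>
  A Lie algebra over a field of arbitrary characteristic, of arbitrary dimension, is carried by
  the whole type \<open>'b\<close>; Lie subalgebras are subsets of it. The bracket is required
  to be alternating, not just antisymmetric, which matters in characteristic 2.
\<close>

locale lie_algebra = vector_space scale
  for scale :: "'a::field \<Rightarrow> 'b::ab_group_add \<Rightarrow> 'b" (infixr \<open>*s\<close> 75) +
  fixes bracket :: "'b \<Rightarrow> 'b \<Rightarrow> 'b"
  assumes linear_bracket_left: "Vector_Spaces.linear scale scale (\<lambda>x. bracket x y)"
    and linear_bracket_right: "Vector_Spaces.linear scale scale (\<lambda>y. bracket x y)"
    and bracket_alternating: "bracket x x = 0"
    and jacobi: "bracket x (bracket y z) + bracket y (bracket z x) + bracket z (bracket x y) = 0"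
begin

definition lie_subalgebra :: "'b set \<Rightarrow> bool" where
  "lie_subalgebra H \<longleftrightarrow> subspace H \<and> (\<forall>x\<in>H. \<forall>y\<in>H. bracket x y \<in> H)"

definition abelian_subalgebra :: "'b set \<Rightarrow> bool" where
  "abelian_subalgebra H \<longleftrightarrow> lie_subalgebra H \<and> (\<forall>x\<in>H. \<forall>y\<in>H. bracket x y = 0)"

definition subspace_direct_sum :: "'b set \<Rightarrow> 'b set \<Rightarrow> 'b set \<Rightarrow> bool" where
  "subspace_direct_sum H A B \<longleftrightarrow>
     subspace A \<and> subspace B \<and> H = {a + b | a b. a \<in> A \<and> b \<in> B} \<and> A \<inter> B = {0}"

text \<open>
  There are no quotient spaces in the library, so the codimension of \<open>V\<close> in \<open>H\<close> is
  taken to be the dimension of a linear complement, which is isomorphic to \<open>H / V\<close>.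
  Infinite-dimensional spaces have \<open>dim\<close> equal to 0, so \<open>dim U = 1\<close> does mean that
  \<open>U\<close> is a line.
\<close>

definition codimension_one :: "'b set \<Rightarrow> 'b set \<Rightarrow> bool" where
  "codimension_one V H \<longleftrightarrow> (\<exists>U. subspace_direct_sum H V U \<and> dim U = 1)"

definition almost_abelian :: "'b set \<Rightarrow> bool" where
  "almost_abelian H \<longleftrightarrow>
     lie_subalgebra H \<and> \<not> abelian_subalgebra H \<and>
     (\<exists>V. abelian_subalgebra V \<and> codimension_one V H)"

definition lie_direct_sum :: "'b set \<Rightarrow> 'b set \<Rightarrow> 'b set \<Rightarrow> bool" where
  "lie_direct_sum H A B \<longleftrightarrow>
     lie_subalgebra A \<and> lie_subalgebra B \<and> subspace_direct_sum H A B \<and>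
     (\<forall>a\<in>A. \<forall>b\<in>B. bracket a b = 0)"

definition decomposable :: "'b set \<Rightarrow> bool" where
  "decomposable H \<longleftrightarrow> (\<exists>A B. A \<noteq> {0} \<and> B \<noteq> {0} \<and> lie_direct_sum H A B)"

definition lie_isomorphism :: "'b set \<Rightarrow> 'b set \<Rightarrow> ('b \<Rightarrow> 'b) \<Rightarrow> bool" where
  "lie_isomorphism A B f \<longleftrightarrow>
     bij_betw f A B \<and>
     (\<forall>x\<in>A. \<forall>y\<in>A. f (x + y) = f x + f y) \<and>
     (\<forall>c. \<forall>x\<in>A. f (c *s x) = c *s f x) \<and>
     (\<forall>x\<in>A. \<forall>y\<in>A. f (bracket x y) = bracket (f x) (f y))"

definition lie_isomorphic :: "'b set \<Rightarrow> 'b set \<Rightarrow> bool" where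
  "lie_isomorphic A B \<longleftrightarrow> (\<exists>f. lie_isomorphism A B f)"

definition almost_abelian_decomposition :: "'b set \<Rightarrow> 'b set \<Rightarrow> 'b set \<Rightarrow> bool" where
  "almost_abelian_decomposition L L0 W \<longleftrightarrow>
     lie_direct_sum L L0 W \<and>
     almost_abelian L0 \<and> \<not> decomposable L0 \<and>
     abelian_subalgebra W"

end

end

theory Submission
  imports Defs
begin

text \<open>
  The decomposition is governed by two canonical subspaces of a Lie algebra \<open>L\<close>, its centre
  \<open>Z\<close> and its derived algebra \<open>D\<close>, and the key point is that an almost Abelian Lie algebra is
  indecomposable exactly when \<open>Z \<subseteq> D\<close> (\<open>indecomposable_iff_centre_le_derived\<close>).  If
  \<open>Z \<subseteq> D\<close>, then no nonzero Abelian summand can split off, since such a summand is central and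
  meets \<open>D\<close> trivially; and two non-Abelian summands are impossible, because an Abelian
  subspace of codimension one leaves room for noncommuting elements in one summand only
  (\<open>abelian_summand\<close>).  If \<open>Z \<subseteq> D\<close> fails, a complement of \<open>Z \<inter> D\<close> in \<open>Z\<close> does split off.

  Splitting off such a complement \<open>W\<close> is also how the decomposition is found: \<open>W\<close> meets \<open>D\<close>
  trivially, so it has a complement \<open>L\<^sub>0\<close> in \<open>L\<close> that contains \<open>D\<close>.  This makes \<open>L\<^sub>0\<close> an ideal, whose
  centre has been cut down to \<open>Z \<inter> D\<close> while its derived algebra is still \<open>D\<close>
  (\<open>split_off_central_summand\<close>).

  For uniqueness, the criterion shows that in any decomposition \<open>W\<close> is a complement of \<open>Z \<inter> D\<close>
  in \<open>Z\<close> and that \<open>L\<^sub>0\<close> contains \<open>Z \<inter> D\<close>.  Hence \<open>W\<close> and \<open>W'\<close> are complements of one and the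
  same subspace \<open>Z \<inter> D\<close> of \<open>Z\<close>, and both \<open>L\<^sub>0\<close> and \<open>L\<^sub>0'\<close> are complements of \<open>W'\<close> in \<open>L\<close>.  In each
  case the projection along the common complement is bijective, and it respects brackets because
  that complement is central (\<open>complements_of_central_isomorphic\<close>).
\<close>

context lie_algebra
begin

section \<open>Complements of subspaces\<close>

lemma subspace_direct_sum_commute:
  assumes "subspace_direct_sum H A B"
  shows "subspace_direct_sum H B A"
proof -
  have "{a + b | a b. a \<in> A \<and> b \<in> B} = {b + a | b a. b \<in> B \<and> a \<in> A}"
    by (metis (no_types, opaque_lifting) add.commute)
  then show ?thesis
    using assms unfolding subspace_direct_sum_def by (simp add: Int_commute)
qed

lemma subspace_direct_sum_cases:
  assumes "subspace_direct_sum H A B" and "x \<in> H"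
  obtains a b where "a \<in> A" "b \<in> B" "x = a + b"
  using assms unfolding subspace_direct_sum_def by blast

lemma subspace_direct_sum_subsets:
  assumes "subspace_direct_sum H A B"
  shows "A \<subseteq> H" "B \<subseteq> H"
proof -
  have "0 \<in> A" "0 \<in> B"
    using assms by (auto simp: subspace_direct_sum_def subspace_0)
  moreover have "a = a + 0" "a = 0 + a" for a :: 'b
    by simp_all
  ultimately show "A \<subseteq> H" "B \<subseteq> H"
    using assms unfolding subspace_direct_sum_def by blast+
qed

lemma subspace_direct_sum_disjoint:
  "subspace_direct_sum H A B \<Longrightarrow> x \<in> A \<Longrightarrow> x \<in> B \<Longrightarrow> x = 0"
  by (auto simp: subspace_direct_sum_def)

lemma subspace_direct_sumI:
  assumes "subspace H" "subspace A" "subspace B" "A \<subseteq> H" "B \<subseteq> H"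
    and "\<And>x. x \<in> H \<Longrightarrow> \<exists>a\<in>A. x - a \<in> B"
    and "\<And>x. x \<in> A \<Longrightarrow> x \<in> B \<Longrightarrow> x = 0"
  shows "subspace_direct_sum H A B"
  unfolding subspace_direct_sum_def
proof (intro conjI)
  show "H = {a + b | a b. a \<in> A \<and> b \<in> B}"
  proof
    show "H \<subseteq> {a + b | a b. a \<in> A \<and> b \<in> B}"
      using assms(6) by (smt (verit) add_diff_cancel_left' diff_add_cancel add.commute mem_Collect_eq subsetI)
    show "{a + b | a b. a \<in> A \<and> b \<in> B} \<subseteq> H"
      using assms(1,4,5) by (auto intro: subspace_add)
  qed
  show "A \<inter> B = {0}"
    using assms(2,3,7) by (auto simp: subspace_0)
qed (use assms in auto)

text \<open>
  The complement is the preimage of \<open>T\<close> under a projection of \<open>H\<close> onto \<open>S + T\<close>.  The subspace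
  \<open>T\<close> will be the derived algebra, so that the complement is an ideal; taking \<open>T = {0}\<close> gives
  the bare existence of complements.
\<close>

lemma complement_containing:
  assumes H: "subspace H" and S: "subspace S" "S \<subseteq> H" and T: "subspace T" "T \<subseteq> H"
    and disjoint: "S \<inter> T = {0}"
  shows "\<exists>C. subspace_direct_sum H S C \<and> T \<subseteq> C"
proof -
  interpret pair: vector_space_pair scale scale ..
  define P where "P = {s + t | s t. s \<in> S \<and> t \<in> T}"
  have P: "subspace P"
    unfolding P_def by (rule subspace_sums[OF S(1) T(1)])
  have PH: "P \<subseteq> H"
    using H S T unfolding P_def by (auto intro: subspace_add)
  have "Vector_Spaces.linear scale scale (\<lambda>x. x)"
    by (rule linear_ident)
  \<comment> \<open>A left inverse of the inclusion of \<open>P\<close> is a projection onto \<open>P\<close>.\<close>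
  then obtain g where g: "range g \<subseteq> P" "Vector_Spaces.linear scale scale g"
      "\<And>v. v \<in> P \<Longrightarrow> g v = v"
    using pair.linear_exists_left_inverse_on[of "\<lambda>x. x" P] P by (auto simp: inj_on_def)
  interpret g: Vector_Spaces.linear scale scale g by fact
  define C where "C = {x \<in> H. g x \<in> T}"
  have "subspace_direct_sum H S C"
  proof (rule subspace_direct_sumI)
    show "subspace C"
      unfolding C_def using H T
      by (auto simp: subspace_def g.add g.scale)
    show "\<exists>a\<in>S. x - a \<in> C" if "x \<in> H" for x
    proof -
      obtain s t where st: "s \<in> S" "t \<in> T" "g x = s + t"
        using g(1) unfolding P_def by blast
      have "s \<in> P"
        unfolding P_def using st(1) subspace_0[OF T(1)] by force
      then have "g (x - s) = t"
        using st by (simp add: g.diff g(3))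
      then show ?thesis
        using st that S H by (auto simp: C_def intro!: bexI[of _ s] subspace_diff)
    qed
    show "x = 0" if "x \<in> S" "x \<in> C" for x
    proof -
      have "x \<in> P"
        unfolding P_def using that(1) subspace_0[OF T(1)] by force
      then show ?thesis
        using that disjoint by (auto simp: C_def g(3))
    qed
  qed (use H S in \<open>auto simp: C_def\<close>)
  moreover have "T \<subseteq> C"
  proof
    fix t assume t: "t \<in> T"
    have "t \<in> P"
      unfolding P_def using t subspace_0[OF S(1)] by force
    then show "t \<in> C"
      using t T by (auto simp: C_def g(3))
  qed
  ultimately show ?thesis by blast
qed

section \<open>Subspaces of codimension one\<close>

lemma codimension_one_subspaces:
  assumes "codimension_one V H"
  shows "subspace V" "V \<subseteq> H"
proof -
  obtain U where U: "subspace_direct_sum H V U"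
    using assms unfolding codimension_one_def by blast
  then show "subspace V"
    by (simp add: subspace_direct_sum_def)
  show "V \<subseteq> H"
    by (rule subspace_direct_sum_subsets(1)[OF U])
qed

lemma codimension_one_coset:
  assumes codim: "codimension_one V H" and a: "a \<in> H" "a \<notin> V" and x: "x \<in> H"
  shows "\<exists>c. x - c *s a \<in> V"
proof -
  obtain U where U: "subspace_direct_sum H V U" "dim U = 1"
    using codim unfolding codimension_one_def by blast
  have V: "subspace V" and "subspace U"
    using U unfolding subspace_direct_sum_def by auto
  obtain B where B: "B \<subseteq> U" "independent B" "U \<subseteq> span B" "card B = dim U"
    using basis_exists by blast
  obtain e where "B = {e}"
    using B(4) U(2) card_1_singletonE by metis
  then have multiple: "\<exists>k. u = k *s e" if "u \<in> U" for u
    using B(3) that by (auto simp: span_singleton)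
  obtain v k where v: "v \<in> V" "x = v + k *s e"
    using subspace_direct_sum_cases[OF U(1) x] multiple by metis
  obtain v' k' where v': "v' \<in> V" "a = v' + k' *s e"
    using subspace_direct_sum_cases[OF U(1) a(1)] multiple by metis
  have "k' \<noteq> 0"
    using v' a(2) by auto
  then have "x - (k / k') *s a = v - (k / k') *s v'"
    by (simp add: v(2) v'(2) scale_right_distrib)
  also have "\<dots> \<in> V"
    using v v' V by (simp add: subspace_diff subspace_scale)
  finally show ?thesis by blast
qed

lemma codimension_one_restrict:
  assumes codim: "codimension_one V H" and A: "subspace A" "A \<subseteq> H" "\<not> A \<subseteq> V"
  shows "codimension_one (V \<inter> A) A"
proof -
  have V: "subspace V"
    using codimension_one_subspaces[OF codim] by blast
  obtain a where a: "a \<in> A" "a \<notin> V"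
    using A(3) by blast
  then have "a \<noteq> 0"
    using subspace_0[OF V] by blast
  have "subspace_direct_sum A (span {a}) (V \<inter> A)"
  proof (rule subspace_direct_sumI)
    show "subspace (V \<inter> A)"
      using V A(1) by (rule subspace_inter)
    show "span {a} \<subseteq> A"
      using a A(1) by (simp add: span_minimal)
    show "\<exists>u\<in>span {a}. x - u \<in> V \<inter> A" if x: "x \<in> A" for x
    proof -
      obtain c where "x - c *s a \<in> V"
        using codimension_one_coset[OF codim] a A(2) x by blast
      moreover have "x - c *s a \<in> A"
        using x a A(1) by (simp add: subspace_diff subspace_scale)
      ultimately show ?thesis
        by (auto simp: span_singleton)
    qed
    show "x = 0" if x: "x \<in> span {a}" "x \<in> V \<inter> A" for x
    proof (rule ccontr)
      assume "x \<noteq> 0"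
      obtain c where c: "x = c *s a"
        using x(1) by (auto simp: span_singleton)
      with \<open>x \<noteq> 0\<close> have "c \<noteq> 0" by auto
      then have "a = inverse c *s x"
        using c by simp
      then show False
        using x(2) a(2) V subspace_scale by auto
    qed
  qed (use A in auto)
  moreover have "dim (span {a}) = 1"
    using \<open>a \<noteq> 0\<close> by (simp add: dim_eq_card_independent)
  ultimately show ?thesis
    unfolding codimension_one_def using subspace_direct_sum_commute by blast
qed

section \<open>Centre and derived algebra\<close>

lemma bracket_simps:
  "bracket (x + y) z = bracket x z + bracket y z"
  "bracket z (x + y) = bracket z x + bracket z y"
  "bracket (x - y) z = bracket x z - bracket y z"
  "bracket z (x - y) = bracket z x - bracket z y"
  "bracket (c *s x) z = c *s bracket x z"
  "bracket z (c *s x) = c *s bracket z x"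
  "bracket 0 z = 0"
  "bracket z 0 = 0"
proof -
  interpret l: Vector_Spaces.linear scale scale "\<lambda>x. bracket x z"
    by (rule linear_bracket_left)
  interpret r: Vector_Spaces.linear scale scale "\<lambda>x. bracket z x"
    by (rule linear_bracket_right)
  show "bracket (x + y) z = bracket x z + bracket y z"
    "bracket (x - y) z = bracket x z - bracket y z"
    "bracket (c *s x) z = c *s bracket x z"
    "bracket 0 z = 0"
    by (rule l.add l.diff l.scale l.zero)+
  show "bracket z (x + y) = bracket z x + bracket z y"
    "bracket z (x - y) = bracket z x - bracket z y"
    "bracket z (c *s x) = c *s bracket z x"
    "bracket z 0 = 0"
    by (rule r.add r.diff r.scale r.zero)+
qed

lemma bracket_antisym: "bracket y x = - bracket x y"
proof -
  have "bracket x y + bracket y x = 0"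
    using bracket_alternating[of "x + y"] unfolding bracket_simps
    by (simp add: bracket_alternating add.commute)
  then show ?thesis
    by (simp add: eq_neg_iff_add_eq_0 add.commute)
qed

definition centre :: "'b set \<Rightarrow> 'b set" where
  "centre H = {z \<in> H. \<forall>x\<in>H. bracket x z = 0}"

definition derived :: "'b set \<Rightarrow> 'b set" where
  "derived H = span {bracket x y | x y. x \<in> H \<and> y \<in> H}"

lemma subspace_centre: "subspace H \<Longrightarrow> subspace (centre H)"
  by (auto simp: subspace_def centre_def bracket_simps)

lemma centre_commutes:
  assumes "z \<in> centre H" "x \<in> H"
  shows "bracket x z = 0" "bracket z x = 0"
  using assms bracket_antisym[of z x] by (auto simp: centre_def)

lemma subspace_derived: "subspace (derived H)"
  by (simp add: derived_def)

lemma bracket_in_derived: "x \<in> H \<Longrightarrow> y \<in> H \<Longrightarrow> bracket x y \<in> derived H"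
  unfolding derived_def by (rule span_base) blast

lemma derived_least:
  assumes "subspace S" "\<And>x y. x \<in> H \<Longrightarrow> y \<in> H \<Longrightarrow> bracket x y \<in> S"
  shows "derived H \<subseteq> S"
  unfolding derived_def using assms by (intro span_minimal) auto

lemma derived_subset: "lie_subalgebra H \<Longrightarrow> derived H \<subseteq> H"
  by (rule derived_least) (auto simp: lie_subalgebra_def)

lemma abelian_iff_derived:
  assumes "lie_subalgebra H"
  shows "abelian_subalgebra H \<longleftrightarrow> derived H \<subseteq> {0}"
proof
  assume "abelian_subalgebra H"
  then show "derived H \<subseteq> {0}"
    by (intro derived_least subspace_single_0) (auto simp: abelian_subalgebra_def)
next
  assume "derived H \<subseteq> {0}"
  then show "abelian_subalgebra H"
    using assms bracket_in_derived unfolding abelian_subalgebra_def by blast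
qed

section \<open>Direct sums of Lie algebras\<close>

lemma lie_direct_sum_commute:
  assumes "lie_direct_sum H A B"
  shows "lie_direct_sum H B A"
proof -
  have "bracket b a = 0" if "a \<in> A" "b \<in> B" for a b
    using assms that bracket_antisym[of b a] by (simp add: lie_direct_sum_def)
  then show ?thesis
    using assms subspace_direct_sum_commute unfolding lie_direct_sum_def by blast
qed

lemma abelian_summand_central:
  assumes sum: "lie_direct_sum H A B" and B: "abelian_subalgebra B"
  shows "B \<subseteq> centre H"
proof
  fix b assume b: "b \<in> B"
  have H: "subspace_direct_sum H A B"
    using sum by (simp add: lie_direct_sum_def)
  have "bracket x b = 0" if "x \<in> H" for x
  proof -
    obtain a b' where "a \<in> A" "b' \<in> B" "x = a + b'"
      using subspace_direct_sum_cases[OF H \<open>x \<in> H\<close>] .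
    then show ?thesis
      using sum B b by (simp add: bracket_simps lie_direct_sum_def abelian_subalgebra_def)
  qed
  moreover have "b \<in> H"
    using subspace_direct_sum_subsets[OF H] b by blast
  ultimately show "b \<in> centre H"
    by (simp add: centre_def)
qed

lemma derived_central_summand:
  assumes sum: "lie_direct_sum H A B" and B: "B \<subseteq> centre H"
  shows "derived H = derived A"
proof
  have H: "subspace_direct_sum H A B"
    using sum by (simp add: lie_direct_sum_def)
  note subsets = subspace_direct_sum_subsets[OF H]
  show "derived A \<subseteq> derived H"
    by (rule derived_least) (use subsets in \<open>auto intro: subspace_derived bracket_in_derived\<close>)
  show "derived H \<subseteq> derived A"
  proof (rule derived_least[OF subspace_derived])
    fix x y assume xy: "x \<in> H" "y \<in> H"
    obtain a b where ab: "a \<in> A" "b \<in> B" "x = a + b"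
      using subspace_direct_sum_cases[OF H xy(1)] .
    obtain a' b' where ab': "a' \<in> A" "b' \<in> B" "y = a' + b'"
      using subspace_direct_sum_cases[OF H xy(2)] .
    have "bracket x b' = 0" "bracket b a' = 0"
      using centre_commutes(1)[of b' H x] centre_commutes(2)[of b H a'] B ab(2) ab'(1,2) xy(1) subsets
      by blast+
    then have "bracket x y = bracket a a'"
      by (simp add: ab(3) ab'(3) bracket_simps)
    then show "bracket x y \<in> derived A"
      using ab ab' by (simp add: bracket_in_derived)
  qed
qed

lemma centre_summand_subset:
  assumes "lie_direct_sum H A B"
  shows "centre A \<subseteq> centre H"
proof
  fix z assume z: "z \<in> centre A"
  have H: "subspace_direct_sum H A B"
    using assms by (simp add: lie_direct_sum_def)
  have "bracket b z = 0" if "b \<in> B" for b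
    using assms that z lie_direct_sum_commute[OF assms] by (auto simp: centre_def lie_direct_sum_def)
  then have "bracket x z = 0" if "x \<in> H" for x
    using z by (auto intro: subspace_direct_sum_cases[OF H that] simp: bracket_simps centre_def)
  then show "z \<in> centre H"
    using z subspace_direct_sum_subsets[OF H] by (auto simp: centre_def)
qed

text \<open>
  The summand \<open>W\<close> is a complement of \<open>Z \<inter> D\<close> in \<open>Z\<close>, a maximal part of the centre that
  avoids the derived algebra; after its removal only \<open>Z \<inter> D\<close> remains central.
\<close>

lemma split_off_central_summand:
  assumes alg: "lie_subalgebra H"
  shows "\<exists>A W. lie_direct_sum H A W \<and> W \<subseteq> centre H \<and> centre A \<subseteq> derived A"
proof -
  have H: "subspace H"
    using alg by (simp add: lie_subalgebra_def)
  define D where "D = centre H \<inter> derived H"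
  have D: "subspace D"
    unfolding D_def by (intro subspace_inter subspace_centre subspace_derived H)
  have "D \<inter> {0} = {0}"
    using subspace_0[OF D] by auto
  then obtain W where W: "subspace_direct_sum (centre H) D W"
    using complement_containing[of "centre H" D "{0}"] D H
    by (auto simp: D_def subspace_centre subspace_0)
  have W_sub: "subspace W" "W \<subseteq> centre H"
    using W subspace_direct_sum_subsets(2) by (auto simp: subspace_direct_sum_def)
  have "W \<inter> derived H = {0}"
  proof -
    have "W \<inter> derived H = D \<inter> W"
      using W_sub by (auto simp: D_def)
    then show ?thesis
      using W by (simp add: subspace_direct_sum_def)
  qed
  moreover have "W \<subseteq> H"
    using W_sub by (auto simp: centre_def)
  ultimately obtain A where A: "subspace_direct_sum H W A" "derived H \<subseteq> A"
    using complement_containing[OF H W_sub(1) _ subspace_derived derived_subset[OF alg]] by blast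
  note subsets = subspace_direct_sum_subsets[OF A(1)]
  have "lie_subalgebra A"
    unfolding lie_subalgebra_def
  proof (intro conjI ballI)
    show "subspace A"
      using A(1) by (simp add: subspace_direct_sum_def)
    show "bracket x y \<in> A" if "x \<in> A" "y \<in> A" for x y
      using that A(2) subsets(2) bracket_in_derived[of x H y] by blast
  qed
  moreover have commute: "bracket x w = 0" if "x \<in> H" "w \<in> W" for x w
    using that W_sub by (auto intro: centre_commutes)
  then have "lie_subalgebra W"
    unfolding lie_subalgebra_def using W_sub subsets by (auto simp: subspace_0)
  ultimately have sum: "lie_direct_sum H A W"
    unfolding lie_direct_sum_def
    using subspace_direct_sum_commute[OF A(1)] commute subsets by blast
  have "centre A \<subseteq> derived H"
  proof
    fix z assume z: "z \<in> centre A"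
    then have "z \<in> centre H"
      using centre_summand_subset[OF sum] by blast
    then obtain d w where dw: "d \<in> D" "w \<in> W" "z = d + w"
      using subspace_direct_sum_cases[OF W] by blast
    have "z - d \<in> A"
      using z dw(1) A by (auto simp: centre_def D_def subspace_direct_sum_def intro!: subspace_diff)
    then have "w = 0"
      using dw subspace_direct_sum_disjoint[OF A(1)] by simp
    then show "z \<in> derived H"
      using dw by (simp add: D_def)
  qed
  then show ?thesis
    using sum W_sub(2) derived_central_summand[OF sum W_sub(2)] by blast
qed

section \<open>Indecomposable almost Abelian Lie algebras\<close>

text \<open>
  A summand inside the Abelian hyperplane \<open>V\<close> is Abelian.  If neither summand lies in \<open>V\<close>, then
  modulo \<open>V\<close> an element \<open>a\<close> of \<open>A\<close> outside \<open>V\<close> is a multiple of an element of \<open>B\<close>.  It thus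
  commutes with \<open>V \<inter> A\<close>, and \<open>A\<close>, being spanned by \<open>V \<inter> A\<close> and \<open>a\<close>, is Abelian.
\<close>

lemma abelian_summand:
  assumes H: "almost_abelian H" and sum: "lie_direct_sum H A B"
  shows "abelian_subalgebra A \<or> abelian_subalgebra B"
proof -
  obtain V where V: "abelian_subalgebra V" "codimension_one V H"
    using H unfolding almost_abelian_def by blast
  have V_commute: "bracket v w = 0" if "v \<in> V" "w \<in> V" for v w
    using V(1) that by (simp add: abelian_subalgebra_def)
  have alg: "lie_subalgebra A" "lie_subalgebra B" and AB: "subspace_direct_sum H A B"
    and commute: "\<And>a b. a \<in> A \<Longrightarrow> b \<in> B \<Longrightarrow> bracket a b = 0"
    using sum by (auto simp: lie_direct_sum_def)
  have "subspace A"
    using alg by (simp add: lie_subalgebra_def)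
  note subsets = subspace_direct_sum_subsets[OF AB]
  show ?thesis
  proof (cases "A \<subseteq> V \<or> B \<subseteq> V")
    case True
    then show ?thesis
      using alg V_commute unfolding abelian_subalgebra_def by blast
  next
    case False
    then obtain a b where ab: "a \<in> A" "a \<notin> V" "b \<in> B" "b \<notin> V" by blast
    obtain k where k: "a - k *s b \<in> V"
      using codimension_one_coset[OF V(2)] ab subsets by blast
    have a_commute: "bracket y a = 0" if "y \<in> V" "y \<in> A" for y
    proof -
      have "bracket y (a - k *s b) = 0"
        using k that by (simp add: V_commute)
      then show ?thesis
        using commute[OF that(2) ab(3)] by (simp add: bracket_simps)
    qed
    have "bracket x y = 0" if xy: "x \<in> A" "y \<in> A" for x y
    proof -
      obtain c where c: "x - c *s a \<in> V"
        using codimension_one_coset[OF V(2)] ab subsets xy by blast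
      obtain d where d: "y - d *s a \<in> V"
        using codimension_one_coset[OF V(2)] ab subsets xy by blast
      define x' y' where "x' = x - c *s a" and "y' = y - d *s a"
      have x': "x = x' + c *s a" "x' \<in> V" "x' \<in> A"
        using c xy ab \<open>subspace A\<close> by (auto simp: x'_def intro: subspace_diff subspace_scale)
      have y': "y = y' + d *s a" "y' \<in> V" "y' \<in> A"
        using d xy ab \<open>subspace A\<close> by (auto simp: y'_def intro: subspace_diff subspace_scale)
      have "bracket a y' = 0"
        using a_commute[OF y'(2,3)] bracket_antisym[of a y'] by simp
      then show ?thesis
        unfolding x'(1) y'(1) using a_commute[OF x'(2,3)] V_commute[OF x'(2) y'(2)]
        by (simp add: bracket_simps bracket_alternating)
    qed
    then show ?thesis
      using alg by (simp add: abelian_subalgebra_def)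
  qed
qed

text \<open>
  From left to right, the central summand \<open>W\<close> of \<open>split_off_central_summand\<close> has to vanish,
  since the other summand carries the nonzero derived algebra.  From right to left, one of two
  summands is Abelian; it is then central, hence inside the derived algebra, which the other
  summand contains, so it vanishes.
\<close>

lemma indecomposable_iff_centre_le_derived:
  assumes H: "almost_abelian H"
  shows "\<not> decomposable H \<longleftrightarrow> centre H \<subseteq> derived H"
proof
  have alg: "lie_subalgebra H" and nonabelian: "\<not> abelian_subalgebra H"
    using H by (auto simp: almost_abelian_def)
  assume indec: "\<not> decomposable H"
  obtain A W where sum: "lie_direct_sum H A W" and W: "W \<subseteq> centre H"
    and A: "centre A \<subseteq> derived A"
    using split_off_central_summand[OF alg] by blast
  have derived: "derived H = derived A"
    by (rule derived_central_summand[OF sum W])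
  have "lie_subalgebra A"
    using sum by (simp add: lie_direct_sum_def)
  have "A \<noteq> {0}"
    using nonabelian derived derived_subset[OF \<open>lie_subalgebra A\<close>] abelian_iff_derived[OF alg] by auto
  then have "W = {0}"
    using indec sum unfolding decomposable_def by blast
  then have "H = A"
    using sum by (auto simp: lie_direct_sum_def subspace_direct_sum_def)
  then show "centre H \<subseteq> derived H"
    using A by simp
next
  assume central: "centre H \<subseteq> derived H"
  have trivial: "B = {0}" if sum: "lie_direct_sum H A B" and B: "abelian_subalgebra B" for A B
  proof -
    have "B \<subseteq> centre H"
      by (rule abelian_summand_central[OF sum B])
    moreover have "derived H = derived A"
      by (rule derived_central_summand[OF sum]) fact
    moreover have "derived A \<subseteq> A"
      using sum by (intro derived_subset) (simp add: lie_direct_sum_def)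
    ultimately have "B \<subseteq> A \<inter> B"
      using central by blast
    then show ?thesis
      using sum by (auto simp: lie_direct_sum_def subspace_direct_sum_def)
  qed
  show "\<not> decomposable H"
    unfolding decomposable_def
    using abelian_summand[OF H] trivial lie_direct_sum_commute by blast
qed

section \<open>Existence\<close>

lemma almost_abelian_summand:
  assumes H: "almost_abelian H" and sum: "lie_direct_sum H A W" and W: "W \<subseteq> centre H"
  shows "almost_abelian A"
proof -
  obtain V where V: "abelian_subalgebra V" "codimension_one V H"
    using H unfolding almost_abelian_def by blast
  have alg: "lie_subalgebra H" and nonabelian: "\<not> abelian_subalgebra H"
    using H by (auto simp: almost_abelian_def)
  have algA: "lie_subalgebra A" and AW: "subspace_direct_sum H A W"
    using sum by (auto simp: lie_direct_sum_def)
  have nonabelianA: "\<not> abelian_subalgebra A"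
    using nonabelian derived_central_summand[OF sum W]
    by (simp add: abelian_iff_derived alg algA)
  then have "\<not> A \<subseteq> V"
    using V(1) algA unfolding abelian_subalgebra_def by blast
  then have "codimension_one (V \<inter> A) A"
    using codimension_one_restrict[OF V(2)] algA subspace_direct_sum_subsets[OF AW]
    by (simp add: lie_subalgebra_def)
  moreover have "abelian_subalgebra (V \<inter> A)"
    using V(1) algA
    by (auto simp: abelian_subalgebra_def lie_subalgebra_def subspace_inter subspace_0)
  ultimately show ?thesis
    using algA nonabelianA unfolding almost_abelian_def by blast
qed

lemma decomposition_exists:
  assumes H: "almost_abelian H"
  shows "\<exists>A W. almost_abelian_decomposition H A W"
proof -
  obtain A W where sum: "lie_direct_sum H A W" and W: "W \<subseteq> centre H"
    and A: "centre A \<subseteq> derived A"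
    using split_off_central_summand H unfolding almost_abelian_def by blast
  have "almost_abelian A"
    by (rule almost_abelian_summand[OF H sum W])
  moreover have "abelian_subalgebra W"
    using sum W unfolding abelian_subalgebra_def lie_direct_sum_def centre_def by blast
  ultimately show ?thesis
    using sum A indecomposable_iff_centre_le_derived
    unfolding almost_abelian_decomposition_def by blast
qed

section \<open>Uniqueness\<close>

text \<open>
  The isomorphism is the projection along the common complement \<open>B\<close>.  It respects brackets
  because a bracket does not change when central elements are added to its arguments.
\<close>

lemma complements_of_central_isomorphic:
  assumes A: "subspace_direct_sum H A B" and A': "subspace_direct_sum H A' B"
    and alg: "lie_subalgebra A" "lie_subalgebra A'" and B: "B \<subseteq> centre H"
  shows "lie_isomorphic A A'"
proof -
  have sub: "subspace A" "subspace A'" "subspace B"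
    using A A' by (auto simp: subspace_direct_sum_def)
  have unique: "x = y" if "x \<in> A" "y \<in> A" "x - y \<in> B" for x y
  proof -
    have "x - y \<in> A"
      using that sub by (simp add: subspace_diff)
    then have "x - y = 0"
      using subspace_direct_sum_disjoint[OF A] that(3) by blast
    then show ?thesis
      by simp
  qed
  have unique': "x = y" if "x \<in> A'" "y \<in> A'" "x - y \<in> B" for x y
  proof -
    have "x - y \<in> A'"
      using that sub by (simp add: subspace_diff)
    then have "x - y = 0"
      using subspace_direct_sum_disjoint[OF A'] that(3) by blast
    then show ?thesis
      by simp
  qed
  define f where "f x = (SOME y. y \<in> A' \<and> x - y \<in> B)" for x
  have f: "f x \<in> A' \<and> x - f x \<in> B" if "x \<in> A" for x
  proof -
    have "x \<in> H"
      using that subspace_direct_sum_subsets[OF A] by blast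
    then have "\<exists>y. y \<in> A' \<and> x - y \<in> B"
      using subspace_direct_sum_cases[OF A'] by (metis add_diff_cancel_left')
    then show ?thesis
      unfolding f_def by (rule someI_ex)
  qed
  have f_eqI: "f x = y" if "x \<in> A" "y \<in> A'" "x - y \<in> B" for x y
  proof (rule unique')
    show "f x - y \<in> B"
      using subspace_diff[OF sub(3) that(3), of "x - f x"] f[OF that(1)] by simp
  qed (use that f in auto)
  have "bij_betw f A A'"
  proof (rule bij_betw_imageI)
    show "inj_on f A"
    proof
      fix x y assume xy: "x \<in> A" "y \<in> A" "f x = f y"
      have "x - y \<in> B"
        using subspace_diff[OF sub(3), of "x - f x" "y - f y"] f[OF xy(1)] f[OF xy(2)] xy(3)
        by simp
      then show "x = y"
        using xy by (intro unique)
    qed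
    show "f ` A = A'"
    proof
      show "f ` A \<subseteq> A'"
        using f by blast
      show "A' \<subseteq> f ` A"
      proof
        fix y assume y: "y \<in> A'"
        then have "y \<in> H"
          using subspace_direct_sum_subsets[OF A'] by blast
        then obtain x b where xb: "x \<in> A" "b \<in> B" "y = x + b"
          using subspace_direct_sum_cases[OF A] by blast
        have "x - y \<in> B"
          using xb subspace_neg[OF sub(3)] by simp
        then have "f x = y"
          using xb y by (intro f_eqI)
        then show "y \<in> f ` A"
          using xb by blast
      qed
    qed
  qed
  moreover have "f (x + y) = f x + f y" if "x \<in> A" "y \<in> A" for x y
  proof (rule f_eqI)
    show "x + y - (f x + f y) \<in> B"
      using subspace_add[OF sub(3), of "x - f x" "y - f y"] f that
      by (simp add: algebra_simps)
  qed (use f that sub in \<open>auto intro: subspace_add\<close>)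
  moreover have "f (c *s x) = c *s f x" if "x \<in> A" for c x
  proof (rule f_eqI)
    have "c *s (x - f x) \<in> B"
      using f that sub by (simp add: subspace_scale)
    then show "c *s x - c *s f x \<in> B"
      by (simp add: scale_right_diff_distrib)
  qed (use f that sub in \<open>auto intro: subspace_scale\<close>)
  moreover have "f (bracket x y) = bracket (f x) (f y)" if xy: "x \<in> A" "y \<in> A" for x y
  proof (rule f_eqI)
    have "x \<in> H" "f y \<in> H"
      using xy f subspace_direct_sum_subsets[OF A] subspace_direct_sum_subsets[OF A'] by blast+
    moreover have "x - f x \<in> centre H" "y - f y \<in> centre H"
      using xy f B by blast+
    ultimately have "bracket x (y - f y) = 0" "bracket (x - f x) (f y) = 0"
      by (auto intro: centre_commutes)
    then have "bracket x y = bracket (f x) (f y)"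
      by (simp add: bracket_simps)
    then show "bracket x y - bracket (f x) (f y) \<in> B"
      using sub by (simp add: subspace_0)
  qed (use f xy alg in \<open>auto simp: lie_subalgebra_def\<close>)
  ultimately show ?thesis
    unfolding lie_isomorphic_def lie_isomorphism_def by blast
qed

lemma decomposition_central:
  assumes "almost_abelian_decomposition H A W"
  shows "W \<subseteq> centre H" "derived H = derived A" "centre A \<subseteq> derived A"
proof -
  have sum: "lie_direct_sum H A W" and W: "abelian_subalgebra W"
    and A: "almost_abelian A" "\<not> decomposable A"
    using assms by (auto simp: almost_abelian_decomposition_def)
  show "W \<subseteq> centre H"
    by (rule abelian_summand_central[OF sum W])
  then show "derived H = derived A"
    by (rule derived_central_summand[OF sum])
  show "centre A \<subseteq> derived A"
    using A indecomposable_iff_centre_le_derived by blast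
qed

lemma decomposition_complement:
  assumes dec: "almost_abelian_decomposition H A W"
  shows "subspace_direct_sum (centre H) (centre H \<inter> derived H) W"
    and "centre H \<inter> A \<subseteq> derived H"
    and "derived H \<subseteq> A"
proof -
  have A: "lie_subalgebra A" and sum: "subspace_direct_sum H A W"
    using dec by (auto simp: almost_abelian_decomposition_def lie_direct_sum_def)
  have sub: "subspace A" "subspace W"
    using sum by (auto simp: subspace_direct_sum_def)
  have H: "subspace H"
    using sum subspace_sums[OF sub] by (simp add: subspace_direct_sum_def)
  note central = decomposition_central[OF dec]
  have "centre H \<inter> A \<subseteq> centre A"
    using subspace_direct_sum_subsets[OF sum] by (auto simp: centre_def)
  then show le: "centre H \<inter> A \<subseteq> derived H"
    using central by blast
  show ge: "derived H \<subseteq> A"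
    using central derived_subset[OF A] by simp
  show "subspace_direct_sum (centre H) (centre H \<inter> derived H) W"
  proof (rule subspace_direct_sumI)
    show "\<exists>d\<in>centre H \<inter> derived H. z - d \<in> W" if z: "z \<in> centre H" for z
    proof -
      have "z \<in> H"
        using z by (simp add: centre_def)
      then obtain a w where aw: "a \<in> A" "w \<in> W" "z = a + w"
        using subspace_direct_sum_cases[OF sum] by blast
      have "z - w \<in> centre H"
        using z aw(2) central(1) H by (auto intro: subspace_diff subspace_centre)
      then have "a \<in> centre H \<inter> derived H"
        using le aw by auto
      then show ?thesis
        using aw by (intro bexI[of _ a]) auto
    qed
    show "x = 0" if "x \<in> centre H \<inter> derived H" "x \<in> W" for x
      using that ge sum by (auto simp: subspace_direct_sum_def)
  qed (use H sub central in \<open>auto intro: subspace_inter subspace_centre subspace_derived\<close>)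
qed

text \<open>
  All the Abelian summands that occur in decompositions are complements of \<open>Z \<inter> D\<close> in \<open>Z\<close>.
  They thus agree modulo \<open>Z \<inter> D\<close>, which lies in \<open>A\<close>, so one can be exchanged for another.
\<close>

lemma decomposition_exchange:
  assumes dec: "almost_abelian_decomposition H A W"
    and dec': "almost_abelian_decomposition H A' W'"
  shows "subspace_direct_sum H A W'"
proof (rule subspace_direct_sumI)
  have sum: "subspace_direct_sum H A W" and sum': "subspace_direct_sum H A' W'"
    using dec dec' by (auto simp: almost_abelian_decomposition_def lie_direct_sum_def)
  note subsets = subspace_direct_sum_subsets[OF sum] subspace_direct_sum_subsets[OF sum']
  show sub: "subspace A" "subspace W'"
    using sum sum' by (auto simp: subspace_direct_sum_def)
  show "subspace H"
    using sum subspace_sums by (auto simp: subspace_direct_sum_def)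
  show "A \<subseteq> H" "W' \<subseteq> H"
    using subsets by auto
  note complement = decomposition_complement[OF dec] and complement' = decomposition_complement[OF dec']
  note W' = decomposition_central(1)[OF dec']
  show "\<exists>a\<in>A. x - a \<in> W'" if x: "x \<in> H" for x
  proof -
    obtain a w where aw: "a \<in> A" "w \<in> W" "x = a + w"
      using subspace_direct_sum_cases[OF sum x] .
    have "w \<in> centre H"
      using aw decomposition_central(1)[OF dec] by blast
    then obtain d w' where dw: "d \<in> centre H \<inter> derived H" "w' \<in> W'" "w = d + w'"
      using subspace_direct_sum_cases[OF complement'(1)] by blast
    have "a + d \<in> A"
      using aw dw complement(3) sub by (auto intro: subspace_add)
    then show ?thesis
      using aw dw by (intro bexI[of _ "a + d"]) auto
  qed
  show "x = 0" if "x \<in> A" "x \<in> W'" for x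
    using that W' complement(2) complement'(1) by (auto simp: subspace_direct_sum_def)
qed

lemma decomposition_unique:
  assumes dec: "almost_abelian_decomposition H A W"
    and dec': "almost_abelian_decomposition H A' W'"
  shows "lie_isomorphic A A'" "lie_isomorphic W W'"
proof -
  have alg: "lie_subalgebra A" "lie_subalgebra A'" "lie_subalgebra W" "lie_subalgebra W'"
    using dec dec' by (auto simp: almost_abelian_decomposition_def lie_direct_sum_def)
  show "lie_isomorphic A A'"
    by (rule complements_of_central_isomorphic[OF decomposition_exchange[OF dec dec']
          decomposition_exchange[OF dec' dec'] alg(1,2) decomposition_central(1)[OF dec']])
  show "lie_isomorphic W W'"
  proof (rule complements_of_central_isomorphic)
    show "subspace_direct_sum (centre H) W (centre H \<inter> derived H)"
      "subspace_direct_sum (centre H) W' (centre H \<inter> derived H)"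
      using decomposition_complement(1) dec dec' subspace_direct_sum_commute by blast+
    \<comment> \<open>The ambient Lie algebra is here \<open>centre H\<close>, which is its own centre.\<close>
    show "centre H \<inter> derived H \<subseteq> centre (centre H)"
      by (auto simp: centre_def)
  qed (use alg in auto)
qed

end

theorem proposition4:
  fixes scale :: "'a::field \<Rightarrow> 'b::ab_group_add \<Rightarrow> 'b"
    and bracket :: "'b \<Rightarrow> 'b \<Rightarrow> 'b"
  assumes "lie_algebra scale bracket"
    and "lie_algebra.almost_abelian scale bracket UNIV"
  shows "(\<exists>L0 W. lie_algebra.almost_abelian_decomposition scale bracket UNIV L0 W) \<and>
    (\<forall>L0 W L0' W'.
       lie_algebra.almost_abelian_decomposition scale bracket UNIV L0 W \<longrightarrow>
       lie_algebra.almost_abelian_decomposition scale bracket UNIV L0' W' \<longrightarrow>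
       lie_algebra.lie_isomorphic scale bracket L0 L0' \<and>
       lie_algebra.lie_isomorphic scale bracket W W')"
proof -
  interpret lie_algebra scale bracket by fact
  show ?thesis
    using decomposition_exists[OF assms(2)] decomposition_unique by blast
qed

end
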